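(* Let $\mathcal{R}$ be a finite simple Lie conformal superalgebra over $\mathbb{C}$. Then every conformal triple derivation of $\mathcal{R}$ is a conformal derivation and conversely, i.e. $CTDer(\mathcal{R})=CDer(\mathcal{R})$.
   Context: All vector spaces are over $\mathbb{C}$. A Lie conformal superalgebra is a $\mathbb{Z}_2$-graded $\mathbb{C}[\partial]$-module $\mathcal{R}=\mathcal{R}_{\bar 0}\oplus\mathcal{R}_{\bar 1}$ with a $\mathbb{C}$-linear map $\mathcal{R}\otimes\mathcal{R}\to\mathbb{C}[\lambda]\otimes\mathcal{R}$, $a\otimes b\mapsto[a_\lambda b]$, compatible with the grading (the bracket of elements of parities $i,j$ has coefficients of parity $i+j$), such that for homogeneous $a,b,c$ (with parities $|a|,|b|,|c|$): $[\partial a_\lambda b]=-\lambda[a_\lambda b]$, $[a_\lambda\partial b]=(\partial+\lambda)[a_\lambda b]$; $[a_\lambda b]=-(-1)^{|a||b|}[b_{-\lambda-\partial}a]$; $[a_\lambda[b_\mu c]]=[[a_\lambda b]_{\lambda+\mu}c]+(-1)^{|a||b|}[b_\mu[a_\lambda c]]$. Writing $[a_\lambda b]=\sum_n\frac{\lambda^n}{n!}a_{(n)}b$, an ideal is a $\mathbb{C}[\partial]$-submodule $\mathcal I$ with $a_{(n)}\mathcal I\subseteq\mathcal I$ for all $a\in\mathcal R$, $n\ge 0$. $\mathcal{R}$ is finite if it is finitely generated as a $\mathbb{C}[\partial]$-module, and simple if it is not abelian (its bracket is not identically zero) and has no non-trivial ideals. A conformal linear map of degree $\alpha\in\{\bar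 0,\bar 1\}$ on $\mathcal{R}$ is a $\mathbb{C}$-linear map $\phi_x:\mathcal{R}\to\mathbb{C}[x]\otimes\mathcal{R}$ with $\phi_x(\partial a)=(\partial+x)\phi_x(a)$ and $\phi_x(\mathcal{R}_\beta)\subseteq\mathcal{R}_{\alpha+\beta}[x]$; write $|\phi|=\alpha$. Brackets and conformal linear maps are extended coefficientwise to polynomials in the formal variables. A conformal linear map $\phi_x$ of degree $\alpha$ is a conformal derivation of degree $\alpha$ if $\phi_x([a_\mu b])=[\phi_x(a)_{x+\mu}b]+(-1)^{|\phi||a|}[a_\mu\phi_x(b)]$ for all homogeneous $a,b$. It is a conformal triple derivation of degree $\alpha$ if for all homogeneous $a,b,c$ $$\phi_x([[a_\lambda b]_{\lambda+\mu}c])=[[\phi_x(a)_{\lambda+x}b]_{\lambda+\mu+x}c]+(-1)^{|\phi||a|}[[a_\lambda\phi_x(b)]_{\lambda+\mu+x}c]+(-1)^{|\phi|(|a|+|b|)}[[a_\lambda b]_{\lambda+\mu}\phi_x(c)].$$ $CDer(\mathcal{R})$ (resp. $CTDer(\mathcal{R})$) is the direct sum over $\alpha\in\{\bar0,\bar1\}$ of the spaces of conformal derivations (resp. conformal triple derivations) of degree $\alpha$. *)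

theory Defs
  imports
    "HOL-Library.Z2"
    "HOL-Library.Poly_Mapping"
    "HOL-Computational_Algebra.Polynomial"
begin

text \<open>
  A \<open>\<complex>[\<partial>]\<close>-module is an instance of the library locale \<^locale>\<open>module\<close> over the ring
  \<^typ>\<open>complex poly\<close>; the underlying complex vector space structure is the action of the
  constant polynomials, and \<open>\<partial>\<close> is the action of the polynomial variable.
\<close>

abbreviation cmult :: "(complex poly \<Rightarrow> 'a \<Rightarrow> 'a) \<Rightarrow> complex \<Rightarrow> 'a \<Rightarrow> 'a"
  where "cmult act c \<equiv> act [:c:]"

abbreviation partial :: "(complex poly \<Rightarrow> 'a \<Rightarrow> 'a) \<Rightarrow> 'a \<Rightarrow> 'a"
  where "partial act \<equiv> act [:0, 1:]"

text \<open>
  Values of a \<open>\<lambda>\<close>-bracket and of a conformal linear map are one-variable polynomials with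
  coefficients in \<open>\<R>\<close>, of type \<^typ>\<open>'a poly\<close>; multiplication by the variable is
  \<^term>\<open>pCons 0\<close>. Identities that involve several formal variables are stated in
  \<open>\<R>[\<lambda>,\<mu>,x]\<close>, i.e. for finitely supported functions from monomials to \<open>\<R>\<close>.
\<close>

datatype fvar = Lam | Mu | Ex

type_synonym 'a fpoly = "(fvar \<Rightarrow>\<^sub>0 nat) \<Rightarrow>\<^sub>0 'a"

definition const :: "'a::zero \<Rightarrow> 'a fpoly"
  where "const a = Poly_Mapping.single 0 a"

definition mono_mult :: "(fvar \<Rightarrow>\<^sub>0 nat) \<Rightarrow> 'a::comm_monoid_add fpoly \<Rightarrow> 'a fpoly"
  where "mono_mult m u =
    (\<Sum>k\<in>Poly_Mapping.keys u. Poly_Mapping.single (m + k) (Poly_Mapping.lookup u k))"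

text \<open>Multiplication by the linear form that is the sum of the variables in \<open>V\<close>.\<close>

definition lin_mult :: "fvar set \<Rightarrow> 'a::comm_monoid_add fpoly \<Rightarrow> 'a fpoly"
  where "lin_mult V u = (\<Sum>v\<in>V. mono_mult (Poly_Mapping.single v 1) u)"

text \<open>
  Substitution of an operator \<open>T\<close> on \<open>\<R>[\<lambda>,\<mu>,x]\<close> for the variable of a polynomial
  \<open>p = \<Sum>\<^sub>n t\<^sup>n p\<^sub>n\<close>, giving \<open>\<Sum>\<^sub>n T\<^sup>n p\<^sub>n\<close>. Operators rather than scalar polynomials are needed
  for the substitution \<open>-\<lambda>-\<partial>\<close>, where powers of \<open>\<partial>\<close> act on the coefficients.
\<close>

definition psubst :: "('a fpoly \<Rightarrow> 'a fpoly) \<Rightarrow> 'a::comm_monoid_add poly \<Rightarrow> 'a fpoly"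
  where "psubst T p = (\<Sum>n\<le>Polynomial.degree p. (T ^^ n) (const (coeff p n)))"

text \<open>
  The bracket \<open>[u\<^sub>t v]\<close> for \<open>u, v \<in> \<R>[\<lambda>,\<mu>,x]\<close>, extended coefficientwise, where \<open>t\<close> is the
  sum of the variables in \<open>V\<close>.
\<close>

definition fbr ::
    "('a \<Rightarrow> 'a \<Rightarrow> 'a poly) \<Rightarrow> fvar set \<Rightarrow> 'a::comm_monoid_add fpoly \<Rightarrow> 'a fpoly \<Rightarrow> 'a fpoly"
  where "fbr br V u v =
    (\<Sum>k\<in>Poly_Mapping.keys u. \<Sum>l\<in>Poly_Mapping.keys v.
       mono_mult (k + l)
         (psubst (lin_mult V) (br (Poly_Mapping.lookup u k) (Poly_Mapping.lookup v l))))"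

text \<open>The coefficientwise extension of a map \<open>\<phi>\<^sub>x\<close> to \<open>\<R>[\<lambda>,\<mu>,x]\<close>.\<close>

definition fmap :: "('a \<Rightarrow> 'a poly) \<Rightarrow> 'a::comm_monoid_add fpoly \<Rightarrow> 'a fpoly"
  where "fmap \<phi> u =
    (\<Sum>k\<in>Poly_Mapping.keys u.
       mono_mult k (psubst (lin_mult {Ex}) (\<phi> (Poly_Mapping.lookup u k))))"

text \<open>Multiplication by the sign \<open>(-1)\<^sup>p\<close>, for a parity \<open>p \<in> \<int>/2\<int>\<close>.\<close>

definition psign :: "bit \<Rightarrow> 'm::ab_group_add \<Rightarrow> 'm"
  where "psign p u = (if p = 1 then - u else u)"

locale lie_conformal_superalgebra = module act
  for act :: "complex poly \<Rightarrow> 'a::ab_group_add \<Rightarrow> 'a" +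
  fixes gr :: "bit \<Rightarrow> 'a set"
    and br :: "'a \<Rightarrow> 'a \<Rightarrow> 'a poly"
  assumes gr_submodule: "subspace (gr i)"
    and gr_inter: "gr 0 \<inter> gr 1 = {0}"
    and gr_sum: "\<exists>a0\<in>gr 0. \<exists>a1\<in>gr 1. a = a0 + a1"
    and br_add_left: "br (a + a') b = br a b + br a' b"
    and br_add_right: "br a (b + b') = br a b + br a b'"
    and br_cmult_left: "br (cmult act c a) b = map_poly (cmult act c) (br a b)"
    and br_cmult_right: "br a (cmult act c b) = map_poly (cmult act c) (br a b)"
    and br_graded: "a \<in> gr i \<Longrightarrow> b \<in> gr j \<Longrightarrow> coeff (br a b) n \<in> gr (i + j)"
    and br_partial_left: "br (partial act a) b = - pCons 0 (br a b)"
    and br_partial_right: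
      "br a (partial act b) = map_poly (partial act) (br a b) + pCons 0 (br a b)"
    and skew_symmetry: "a \<in> gr i \<Longrightarrow> b \<in> gr j \<Longrightarrow>
      fbr br {Lam} (const a) (const b) =
        - psign (i * j)
            (psubst (\<lambda>u. - lin_mult {Lam} u - Poly_Mapping.map (partial act) u) (br b a))"
    and jacobi: "a \<in> gr i \<Longrightarrow> b \<in> gr j \<Longrightarrow> c' \<in> gr k \<Longrightarrow>
      fbr br {Lam} (const a) (fbr br {Mu} (const b) (const c')) =
        fbr br {Lam, Mu} (fbr br {Lam} (const a) (const b)) (const c')
        + psign (i * j) (fbr br {Mu} (const b) (fbr br {Lam} (const a) (const c')))"
begin

definition nprod :: "nat \<Rightarrow> 'a \<Rightarrow> 'a \<Rightarrow> 'a"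
  where "nprod n a b = cmult act (fact n) (coeff (br a b) n)"

definition ideal :: "'a set \<Rightarrow> bool"
  where "ideal I \<longleftrightarrow> subspace I \<and> (\<forall>a n. \<forall>b\<in>I. nprod n a b \<in> I)"

definition fin_gen :: bool
  where "fin_gen \<longleftrightarrow> (\<exists>S. finite S \<and> span S = UNIV)"

definition abelian :: bool
  where "abelian \<longleftrightarrow> (\<forall>a b. br a b = 0)"

definition simple :: bool
  where "simple \<longleftrightarrow> \<not> abelian \<and> (\<forall>I. ideal I \<longrightarrow> I = {0} \<or> I = UNIV)"

definition conformal_linear :: "bit \<Rightarrow> ('a \<Rightarrow> 'a poly) \<Rightarrow> bool"
  where "conformal_linear \<alpha> \<phi> \<longleftrightarrow>
    (\<forall>a b. \<phi> (a + b) = \<phi> a + \<phi> b) \<and>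
    (\<forall>c a. \<phi> (cmult act c a) = map_poly (cmult act c) (\<phi> a)) \<and>
    (\<forall>a. \<phi> (partial act a) = map_poly (partial act) (\<phi> a) + pCons 0 (\<phi> a)) \<and>
    (\<forall>\<beta>. \<forall>a\<in>gr \<beta>. \<forall>n. coeff (\<phi> a) n \<in> gr (\<alpha> + \<beta>))"

definition conformal_derivation :: "bit \<Rightarrow> ('a \<Rightarrow> 'a poly) \<Rightarrow> bool"
  where "conformal_derivation \<alpha> \<phi> \<longleftrightarrow> conformal_linear \<alpha> \<phi> \<and>
    (\<forall>i j. \<forall>a\<in>gr i. \<forall>b\<in>gr j.
       fmap \<phi> (fbr br {Mu} (const a) (const b)) =
         fbr br {Ex, Mu} (fmap \<phi> (const a)) (const b)
         + psign (\<alpha> * i) (fbr br {Mu} (const a) (fmap \<phi> (const b))))"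

definition conformal_triple_derivation :: "bit \<Rightarrow> ('a \<Rightarrow> 'a poly) \<Rightarrow> bool"
  where "conformal_triple_derivation \<alpha> \<phi> \<longleftrightarrow> conformal_linear \<alpha> \<phi> \<and>
    (\<forall>i j k. \<forall>a\<in>gr i. \<forall>b\<in>gr j. \<forall>c\<in>gr k.
       fmap \<phi> (fbr br {Lam, Mu} (fbr br {Lam} (const a) (const b)) (const c)) =
         fbr br {Lam, Mu, Ex} (fbr br {Lam, Ex} (fmap \<phi> (const a)) (const b)) (const c)
         + psign (\<alpha> * i)
             (fbr br {Lam, Mu, Ex} (fbr br {Lam} (const a) (fmap \<phi> (const b))) (const c))
         + psign (\<alpha> * (i + j))
             (fbr br {Lam, Mu} (fbr br {Lam} (const a) (const b)) (fmap \<phi> (const c))))"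

definition CDer :: "('a \<Rightarrow> 'a poly) set"
  where "CDer = {\<lambda>a. \<phi>0 a + \<phi>1 a | \<phi>0 \<phi>1.
    conformal_derivation 0 \<phi>0 \<and> conformal_derivation 1 \<phi>1}"

definition CTDer :: "('a \<Rightarrow> 'a poly) set"
  where "CTDer = {\<lambda>a. \<phi>0 a + \<phi>1 a | \<phi>0 \<phi>1.
    conformal_triple_derivation 0 \<phi>0 \<and> conformal_triple_derivation 1 \<phi>1}"

end

end

theory Submission
  imports Defs
begin

text \<open>
  Evaluating the formal variables at complex numbers loses no information, so all identities can
  be treated as identities in the algebra itself. Let \<open>D(a,b)\<close> measure the failure of a triple
  derivation \<open>\<phi>\<close> to be a derivation on \<open>[a,b]\<close> (signs and variables suppressed). The triple
  derivation property says \<open>D([a,b],c) = -[D(a,b),c]\<close>, and skew-symmetry turns this into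
  \<open>D(c,[a,b]) = -[c,D(a,b)]\<close>. As the centre is zero, \<open>D(a,b)\<close> depends only on \<open>[a,b]\<close>, whence
  the Jacobi identity gives \<open>D(a,[b,c]) = D([a,b],c) + D(b,[a,c])\<close>. If \<open>a = [a1,a2]\<close>, the Jacobi
  identity for \<open>D(a1,a2)\<close>, \<open>b\<close>, \<open>c\<close> gives the same equation with the opposite sign on the left.
  Hence \<open>D(a,[b,c]) = 0\<close>, and \<open>D = 0\<close> because the algebra is perfect.
\<close>

lemma (in vector_space) in_subspace_if_power_sums:
  assumes S: "subspace S" and fin: "finite K" and inj: "inj_on d K"
    and power_sums: "\<And>j::nat. (\<Sum>k\<in>K. d k ^ j *s u k) \<in> S" and k: "k \<in> K"
  shows "u k \<in> S"
proof -
  have poly_sums: "(\<Sum>l\<in>K. poly q (d l) *s u l) \<in> S" for q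
  proof -
    have "(\<Sum>l\<in>K. poly q (d l) *s u l) = (\<Sum>l\<in>K. \<Sum>j\<le>degree q. coeff q j *s d l ^ j *s u l)"
      by (simp add: poly_altdef scale_sum_left)
    also have "\<dots> = (\<Sum>j\<le>degree q. coeff q j *s (\<Sum>l\<in>K. d l ^ j *s u l))"
      by (subst sum.swap) (simp add: scale_sum_right)
    finally show ?thesis
      using power_sums S by (simp add: subspace_sum subspace_scale)
  qed
  define q where "q = (\<Prod>l\<in>K - {k}. [:- d l, 1:])"
  have q_other: "poly q (d l) = 0" if "l \<in> K - {k}" for l
    using that fin by (auto simp: q_def poly_prod)
  have q_k: "poly q (d k) \<noteq> 0"
    using fin inj k by (auto simp: q_def poly_prod inj_on_def)
  have "(\<Sum>l\<in>K. poly q (d l) *s u l) = poly q (d k) *s u k"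
    using fin k q_other by (subst sum.remove[of _ k]) auto
  then have "inverse (poly q (d k)) *s poly q (d k) *s u k \<in> S"
    using poly_sums[of q] S by (metis subspace_scale)
  then show ?thesis
    using q_k by simp
qed

lemma (in additive) psign: "f (psign p u) = psign p (f u)"
  by (simp add: psign_def minus)

global_interpretation psign: additive "psign p" for p
  by standard (simp add: psign_def)

lemma psign_0 [simp]: "psign 0 u = u"
  and psign_1 [simp]: "psign 1 u = - u"
  by (simp_all add: psign_def)

lemma psign_psign: "psign p (psign q u) = psign (p + q) u"
  by (cases p; cases q) simp_all

locale complex_poly_module = module act
  for act :: "complex poly \<Rightarrow> 'a::ab_group_add \<Rightarrow> 'a"
begin

sublocale C: vector_space "cmult act"
  by standard
    (simp_all add: scale_right_distrib mult.commute flip: scale_left_distrib one_pCons)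

lemma C_subspace_if_subspace: "subspace S \<Longrightarrow> C.subspace S"
  by (simp add: subspace_def C.subspace_def)

lemma act_pCons: "act (pCons c p) u = cmult act c u + partial act (act p u)"
  by (simp flip: scale_left_distrib)

text \<open>The point \<open>t\<close> is a polynomial in \<open>\<partial>\<close>, so that skew-symmetry can be evaluated at \<open>-l-\<partial>\<close>.\<close>

definition ev :: "complex poly \<Rightarrow> 'a poly \<Rightarrow> 'a"
  where "ev t p = (\<Sum>n\<le>degree p. act (t ^ n) (coeff p n))"

lemma ev_0 [simp]: "ev t 0 = 0"
  by (simp add: ev_def)

lemma ev_pCons: "ev t (pCons a p) = a + act t (ev t p)"
proof -
  have "ev t (pCons a p) = (\<Sum>n\<le>Suc (degree p). act (t ^ n) (coeff (pCons a p) n))"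
    unfolding ev_def
    by (rule sum.mono_neutral_left) (auto simp: degree_pCons_le coeff_eq_0 not_le)
  also have "\<dots> = a + (\<Sum>n\<le>degree p. act (t ^ Suc n) (coeff p n))"
    by (subst sum.atMost_Suc_shift) simp
  finally show ?thesis
    by (simp add: ev_def scale_sum_right)
qed

sublocale ev: additive "ev t" for t
proof
  show "ev t (p + q) = ev t p + ev t q" for p q
    by (induction p q rule: poly_induct2) (simp_all add: ev_pCons scale_right_distrib)
qed

lemma ev_map_poly:
  assumes "additive f" and f_act: "\<And>u. f (act t u) = act t' (f u)"
  shows "ev t' (map_poly f p) = f (ev t p)"
proof -
  interpret additive f by fact
  show ?thesis
    by (induction p) (simp_all add: zero map_poly_pCons ev_pCons add f_act)
qed

lemma ev_map_poly_act: "ev t (map_poly (act r) p) = act r (ev t p)"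
  by (rule ev_map_poly) (simp_all add: additive_def scale_right_distrib mult.commute)

lemma ex_ev_shift: "\<exists>q. \<forall>t. ev t q = ev (t + [:x:]) p"
proof (induction p)
  case 0
  show ?case by (auto intro: exI[of _ 0])
next
  case (pCons a p)
  then obtain q where q: "\<And>t. ev t q = ev (t + [:x:]) p" by blast
  have "ev t (pCons a q + map_poly (cmult act x) q) = ev (t + [:x:]) (pCons a p)" for t
    by (simp add: ev.add ev_pCons q ev_map_poly_act scale_left_distrib add.assoc)
  then show ?case by blast
qed

lemma coeff_in_subspace_if_ev:
  assumes S: "C.subspace S" and mem: "\<And>c. ev [:c:] p \<in> S"
  shows "coeff p n \<in> S"
proof (cases "n \<le> degree p")
  case True
  show ?thesis
  proof (rule C.in_subspace_if_power_sums[OF S, of "{..degree p}" "\<lambda>n. of_nat (2 ^ n)"])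
    show "inj_on (\<lambda>n. of_nat (2 ^ n) :: complex) {..degree p}"
      by (simp add: inj_on_def del: of_nat_power)
    fix j :: nat
    have "(of_nat (2 ^ k) :: complex) ^ j = (2 ^ j) ^ k" for k
      by (simp add: mult.commute flip: power_mult)
    then show "(\<Sum>k\<le>degree p. cmult act (of_nat (2 ^ k) ^ j) (coeff p k)) \<in> S"
      using mem[of "2 ^ j"] by (simp only: ev_def poly_const_pow)
  qed (use True in auto)
qed (simp add: coeff_eq_0 C.subspace_0[OF S])

lemma poly_eqI_ev:
  assumes "\<And>c. ev [:c:] p = ev [:c:] q"
  shows "p = q"
proof -
  have "coeff (p - q) n \<in> {0}" for n
    by (rule coeff_in_subspace_if_ev) (simp_all add: ev.diff assms)
  then show ?thesis
    by (intro poly_eqI) auto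
qed

definition monom_val :: "(fvar \<Rightarrow> complex) \<Rightarrow> (fvar \<Rightarrow>\<^sub>0 nat) \<Rightarrow> complex"
  where "monom_val s k = (\<Prod>v\<in>{Lam, Mu, Ex}. s v ^ Poly_Mapping.lookup k v)"

definition fev :: "(fvar \<Rightarrow> complex) \<Rightarrow> 'a fpoly \<Rightarrow> 'a"
  where "fev s u =
    (\<Sum>k\<in>Poly_Mapping.keys u. cmult act (monom_val s k) (Poly_Mapping.lookup u k))"

lemma monom_val_0 [simp]: "monom_val s 0 = 1"
  by (simp add: monom_val_def)

lemma monom_val_add: "monom_val s (k + l) = monom_val s k * monom_val s l"
  unfolding monom_val_def lookup_add power_add by (rule prod.distrib)

lemma monom_val_single: "monom_val s (Poly_Mapping.single v n) = s v ^ n"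
  by (cases v) (simp_all add: monom_val_def lookup_single)

sublocale fev: additive "fev s" for s
  unfolding fev_def by standard (rule setsum_keys_plus_distrib, simp_all add: scale_right_distrib)

lemma fev_single: "fev s (Poly_Mapping.single k a) = cmult act (monom_val s k) a"
  by (simp add: fev_def)

lemma fev_const [simp]: "fev s (const a) = a"
  by (simp add: const_def fev_single flip: one_pCons)

lemma fev_mono_mult: "fev s (mono_mult m u) = cmult act (monom_val s m) (fev s u)"
  by (simp add: mono_mult_def fev.sum fev_single monom_val_add fev_def[of s u] scale_sum_right
      mult.commute)

lemma fev_lin_mult: "fev s (lin_mult V u) = cmult act (sum s V) (fev s u)"
  by (simp add: lin_mult_def fev.sum fev_mono_mult monom_val_single C.scale_sum_left
      del: One_nat_def)

lemma fev_map_act: "fev s (Poly_Mapping.map (act r) u) = act r (fev s u)"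
proof -
  have lookup_map: "Poly_Mapping.lookup (Poly_Mapping.map (act r) u) k =
      act r (Poly_Mapping.lookup u k)" for k
    by (simp add: map.rep_eq when_def)
  then have "fev s (Poly_Mapping.map (act r) u) =
      (\<Sum>k\<in>Poly_Mapping.keys u. cmult act (monom_val s k) (act r (Poly_Mapping.lookup u k)))"
    unfolding fev_def by (intro sum.mono_neutral_cong_left) (auto simp: in_keys_iff)
  then show ?thesis
    by (simp add: fev_def scale_sum_right)
qed

lemma fev_psubst:
  assumes "\<And>u. fev s (T u) = act t (fev s u)"
  shows "fev s (psubst T p) = ev t p"
proof -
  have "fev s ((T ^^ n) u) = act (t ^ n) (fev s u)" for n u
    by (induction n) (auto simp: assms)
  then show ?thesis
    by (simp add: psubst_def ev_def fev.sum)
qed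

lemma fev_psubst_lin_mult: "fev s (psubst (lin_mult V) p) = ev [:sum s V:] p"
  by (rule fev_psubst) (rule fev_lin_mult)

definition goedel_number :: "(fvar \<Rightarrow>\<^sub>0 nat) \<Rightarrow> nat"
  where "goedel_number k = 2 ^ Poly_Mapping.lookup k Lam * 3 ^ Poly_Mapping.lookup k Mu
    * 5 ^ Poly_Mapping.lookup k Ex"

lemma inj_goedel_number: "inj goedel_number"
proof (rule injI)
  fix k l
  assume eq: "goedel_number k = goedel_number l"
  have "multiplicity 2 (goedel_number k) = Poly_Mapping.lookup k Lam"
    "multiplicity 3 (goedel_number k) = Poly_Mapping.lookup k Mu"
    "multiplicity 5 (goedel_number k) = Poly_Mapping.lookup k Ex" for k
    by (simp_all add: goedel_number_def prime_elem_multiplicity_mult_distrib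
        prime_elem_multiplicity_power_distrib multiplicity_same_power prime_multiplicity_other)
  then have "Poly_Mapping.lookup k v = Poly_Mapping.lookup l v" for v
    by (cases v) (metis eq)+
  then show "k = l"
    by (rule poly_mapping_eqI)
qed

lemma monom_val_prime_powers:
  "monom_val (case_fvar (2 ^ j) (3 ^ j) (5 ^ j)) k = of_nat (goedel_number k) ^ j"
  by (simp add: monom_val_def goedel_number_def power_mult_distrib mult.commute flip: power_mult)

lemma fpoly_eq_iff_fev:
  "u = v \<longleftrightarrow> (\<forall>l m x. fev (case_fvar l m x) u = fev (case_fvar l m x) v)"
proof
  assume eq: "\<forall>l m x. fev (case_fvar l m x) u = fev (case_fvar l m x) v"
  have "Poly_Mapping.lookup (u - v) k \<in> {0}" if "k \<in> Poly_Mapping.keys (u - v)" for k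
  proof (rule C.in_subspace_if_power_sums[of _ "Poly_Mapping.keys (u - v)"
      "\<lambda>k. of_nat (goedel_number k)"])
    show "inj_on (\<lambda>k. of_nat (goedel_number k) :: complex) (Poly_Mapping.keys (u - v))"
      using inj_goedel_number by (simp add: inj_on_def)
    show "(\<Sum>k\<in>Poly_Mapping.keys (u - v). cmult act (of_nat (goedel_number k) ^ j)
        (Poly_Mapping.lookup (u - v) k)) \<in> {0}" for j
      using fev.diff[of "case_fvar (2 ^ j) (3 ^ j) (5 ^ j)" u v] eq
      by (simp add: fev_def[of _ "u - v"] monom_val_prime_powers)
  qed (use that in auto)
  then have "u - v = 0"
    by (metis keys_eq_empty all_not_in_conv in_keys_iff singletonD)
  then show "u = v" by simp
qed simp

end

text \<open>
  The map \<open>\<phi>\<^sub>x\<close> and the \<open>\<lambda>\<close>-bracket in its left and right argument are all of this kind, for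
  \<open>s = \<partial> + x\<close>, \<open>s = -\<lambda>\<close> and \<open>s = \<partial> + \<lambda>\<close> respectively.
\<close>

locale semilinear_map = complex_poly_module act + additive f
  for act :: "complex poly \<Rightarrow> 'a::ab_group_add \<Rightarrow> 'a"
    and s :: "complex poly"
    and f :: "'a \<Rightarrow> 'a" +
  assumes cmult: "f (cmult act c u) = cmult act c (f u)"
    and partial: "f (partial act u) = act s (f u)"
begin

lemma act_pcompose: "f (act p u) = act (p \<circ>\<^sub>p s) (f u)"
proof (induction p)
  case (pCons c p)
  then have "f (act (pCons c p) u) = cmult act c (f u) + act s (act (p \<circ>\<^sub>p s) (f u))"
    by (subst act_pCons) (simp only: add cmult partial)
  then show ?case
    by (simp add: pcompose_pCons scale_left_distrib)
qed (simp add: zero)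

lemma subspace_kernel: "subspace {u. f u = 0}"
  by (simp add: subspace_def zero add act_pcompose)

lemma semilinear_map_psign: "semilinear_map act s (\<lambda>u. psign p (f u))"
  by standard
    (simp_all add: psign_def add cmult partial)

lemma ev_pcompose_eqI:
  assumes "\<And>m. f (ev [:m:] p) = ev [:m:] q"
  shows "f (ev t p) = ev (t \<circ>\<^sub>p s) q"
proof -
  have f_ev: "f (ev t p) = ev (t \<circ>\<^sub>p s) (map_poly f p)" for t
    by (rule ev_map_poly[symmetric]) (rule additive_axioms, rule act_pcompose)
  have "map_poly f p = q"
    by (rule poly_eqI_ev) (metis assms f_ev pcompose_const)
  with f_ev show ?thesis by simp
qed

end

lemma semilinear_map_compose:
  assumes "semilinear_map act s f" and "semilinear_map act s' g"
  shows "semilinear_map act (s \<circ>\<^sub>p s') (\<lambda>u. g (f u))"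
proof -
  interpret f: semilinear_map act s f by fact
  interpret g: semilinear_map act s' g by fact
  show ?thesis
    by standard (simp_all add: f.add g.add f.cmult g.cmult f.partial g.act_pcompose)
qed

lemma semilinear_map_diff:
  assumes "semilinear_map act s f" and "semilinear_map act s g"
  shows "semilinear_map act s (\<lambda>u. f u - g u)"
proof -
  interpret f: semilinear_map act s f by fact
  interpret g: semilinear_map act s g by fact
  show ?thesis
    by standard (simp_all add: f.add g.add f.cmult g.cmult f.partial g.partial
        f.scale_right_diff_distrib)
qed

context lie_conformal_superalgebra
begin

sublocale complex_poly_module act ..

definition br_at :: "complex \<Rightarrow> 'a \<Rightarrow> 'a \<Rightarrow> 'a"
  where "br_at l a b = ev [:l:] (br a b)"

sublocale br_at_left: semilinear_map act "[:- l:]" "\<lambda>a. br_at l a b" for l b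
  by standard
    (simp_all add: br_at_def br_add_left br_cmult_left br_partial_left ev.add ev.minus ev_pCons
      ev_map_poly_act)

sublocale br_at_right: semilinear_map act "[:l, 1:]" "br_at l a" for l a
  by standard
    (simp_all add: br_at_def br_add_right br_cmult_right br_partial_right ev.add ev_pCons
      ev_map_poly_act add.commute flip: scale_left_distrib)

lemma gr_psign: "a \<in> gr i \<Longrightarrow> psign p a \<in> gr i"
  by (simp add: psign_def subspace_neg gr_submodule)

lemma gr_ev: "(\<And>n. coeff p n \<in> gr i) \<Longrightarrow> ev t p \<in> gr i"
  unfolding ev_def by (intro subspace_sum gr_submodule subspace_scale)

lemma gr_br_at: "a \<in> gr i \<Longrightarrow> b \<in> gr j \<Longrightarrow> br_at l a b \<in> gr (i + j)"
  unfolding br_at_def by (intro gr_ev br_graded)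

lemma homogeneous_cases:
  obtains a0 a1 where "a0 \<in> gr 0" "a1 \<in> gr 1" "a = a0 + a1"
  using gr_sum by blast

lemma fev_fbr: "fev s (fbr br V u v) = br_at (sum s V) (fev s u) (fev s v)"
proof -
  have "fev s (fbr br V u v) = (\<Sum>k\<in>Poly_Mapping.keys u. \<Sum>l\<in>Poly_Mapping.keys v.
      cmult act (monom_val s k * monom_val s l)
        (br_at (sum s V) (Poly_Mapping.lookup u k) (Poly_Mapping.lookup v l)))"
    by (simp add: fbr_def fev.sum fev_mono_mult fev_psubst_lin_mult monom_val_add flip: br_at_def)
  also have "\<dots> = (\<Sum>k\<in>Poly_Mapping.keys u.
      cmult act (monom_val s k) (br_at (sum s V) (Poly_Mapping.lookup u k) (fev s v)))"
    by (simp add: fev_def br_at_right.sum br_at_right.cmult C.scale_sum_right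
        del: scale_scale C.scale_scale flip: C.scale_scale)
  also have "\<dots> = br_at (sum s V) (fev s u) (fev s v)"
    by (simp add: fev_def[of s u] br_at_left.sum br_at_left.cmult)
  finally show ?thesis .
qed

lemma ev_br_skew:
  assumes "a \<in> gr i" "b \<in> gr j"
  shows "ev [:- l, - 1:] (br b a) = - psign (i * j) (br_at l a b)"
proof -
  let ?s = "case_fvar l 0 0"
  have "fev ?s (- lin_mult {Lam} u - Poly_Mapping.map (partial act) u) = act [:- l, - 1:] (fev ?s u)"
    for u
    unfolding act_pCons[of "- l" "[:- 1:]"]
    by (simp add: fev.diff fev.minus fev_lin_mult fev_map_act)
  from fev_psubst[OF this] have "fev ?s (fbr br {Lam} (const a) (const b)) =
      - psign (i * j) (ev [:- l, - 1:] (br b a))"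
    by (simp add: skew_symmetry[OF assms] fev.minus fev.psign)
  then show ?thesis
    by (simp add: fev_fbr psign_def)
qed

lemma br_at_jacobi:
  assumes "a \<in> gr i" "b \<in> gr j" "c \<in> gr k"
  shows "br_at l a (br_at m b c) =
    br_at (l + m) (br_at l a b) c + psign (i * j) (br_at m b (br_at l a c))"
  using arg_cong[OF jacobi[OF assms], of "fev (case_fvar l m 0)"]
  by (simp add: fev.add fev.psign fev_fbr)

lemma br_eq_0_iff_br_at: "br a b = 0 \<longleftrightarrow> (\<forall>l. br_at l a b = 0)"
  by (auto simp: br_at_def intro: poly_eqI_ev)

definition center :: "'a set"
  where "center = {z. \<forall>a. br a z = 0}"

lemma ideal_center: "ideal center"
proof -
  have "center = (\<Inter>a. \<Inter>l. {z. br_at l a z = 0})"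
    by (auto simp: center_def br_eq_0_iff_br_at)
  then have "subspace center"
    by (simp add: subspace_Int br_at_right.subspace_kernel)
  moreover have "nprod n a z = 0" if "z \<in> center" for n a z
    using that by (simp add: nprod_def center_def)
  ultimately show ?thesis
    by (simp add: ideal_def subspace_0)
qed

lemma mem_center_if_br_at_left:
  assumes u: "u \<in> gr i" and zero: "\<And>l j z. z \<in> gr j \<Longrightarrow> br_at l u z = 0"
  shows "u \<in> center"
proof -
  have "br u z = 0" if "z \<in> gr j" for z j
    using zero[OF that] by (simp add: br_eq_0_iff_br_at)
  then have homogeneous: "br_at l z u = 0" if "z \<in> gr j" for z j l
    using ev_br_skew[OF that u, of l] that by (simp add: psign_def split: if_splits)
  have "br_at l z u = 0" for z l
    by (rule homogeneous_cases[of z]) (simp add: br_at_left.add homogeneous)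
  then show ?thesis
    by (simp add: center_def br_eq_0_iff_br_at)
qed

lemma eq_if_br_at_left_eq:
  assumes "center = {0}" and "u \<in> gr i" and "v \<in> gr i"
    and "\<And>l j z. z \<in> gr j \<Longrightarrow> br_at l u z = br_at l v z"
  shows "u = v"
proof -
  have "u - v \<in> center"
    using assms by (intro mem_center_if_br_at_left[of _ i])
      (auto simp: br_at_left.diff intro: subspace_diff gr_submodule)
  with \<open>center = {0}\<close> show ?thesis by simp
qed

definition derived :: "'a set"
  where "derived = span {coeff (br a b) n | a b n. True}"

lemma coeff_br_in_derived: "coeff (br a b) n \<in> derived"
  unfolding derived_def by (rule span_base) blast

lemma ideal_derived: "ideal derived"
proof -
  have "subspace derived"
    by (simp add: derived_def)
  then show ?thesis
    by (simp add: ideal_def nprod_def subspace_scale coeff_br_in_derived)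
qed

lemma derived_subset:
  assumes S: "subspace S"
    and br_at: "\<And>l i j a b. a \<in> gr i \<Longrightarrow> b \<in> gr j \<Longrightarrow> br_at l a b \<in> S"
  shows "derived \<subseteq> S"
proof -
  have "br_at l a b \<in> S" for l a b
    by (rule homogeneous_cases[of a], rule homogeneous_cases[of b])
      (simp add: br_at_left.add br_at_right.add subspace_add[OF S] br_at)
  then have "coeff (br a b) n \<in> S" for a b n
    by (intro coeff_in_subspace_if_ev C_subspace_if_subspace S) (simp add: br_at_def)
  then show ?thesis
    unfolding derived_def by (intro span_minimal S) blast
qed

lemma gr_subset_if_perfect:
  assumes "derived = UNIV" and K: "\<And>j. subspace (K j)" "\<And>j. K j \<subseteq> gr j"
    and br_at: "\<And>l i j a b. a \<in> gr i \<Longrightarrow> b \<in> gr j \<Longrightarrow> br_at l a b \<in> K (i + j)"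
  shows "gr i \<subseteq> K i"
proof
  fix a
  assume a: "a \<in> gr i"
  have "derived \<subseteq> span (K i \<union> K (i + 1))"
  proof (rule derived_subset)
    fix l g h u v
    assume "u \<in> gr g" "v \<in> gr h"
    then have "br_at l u v \<in> K (g + h)"
      by (rule br_at)
    moreover have "g + h = i \<or> g + h = i + 1"
      by (cases "g + h"; cases i) simp_all
    ultimately show "br_at l u v \<in> span (K i \<union> K (i + 1))"
      by (auto intro: span_base)
  qed simp
  then have "a \<in> {u + v | u v. u \<in> K i \<and> v \<in> K (i + 1)}"
    unfolding span_Un K(1)[folded span_eq_iff] using \<open>derived = UNIV\<close> by blast
  then obtain u v where u: "u \<in> K i" and v: "v \<in> K (i + 1)" and a_eq: "a = u + v"
    by blast
  have "v \<in> gr i"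
    using subspace_diff[OF gr_submodule a, of u] u K(2) a_eq by auto
  then have "v \<in> gr i \<inter> gr (i + 1)"
    using v K(2) by blast
  then have "v = 0"
    using gr_inter by (cases i) auto
  with u a_eq show "a \<in> K i" by simp
qed

lemma center_eq_0_if_simple:
  assumes simple
  shows "center = {0}"
proof -
  have "center \<noteq> UNIV"
    using assms by (auto simp: simple_def abelian_def center_def)
  then show ?thesis
    using assms ideal_center unfolding simple_def by blast
qed

lemma derived_eq_UNIV_if_simple:
  assumes simple
  shows "derived = UNIV"
proof -
  have "derived \<noteq> {0}"
  proof
    assume "derived = {0}"
    then have "br a b = 0" for a b
      using coeff_br_in_derived[of a b] by (intro poly_eqI) simp
    then show False
      using assms by (simp add: simple_def abelian_def)
  qed
  then show ?thesis
    using assms ideal_derived unfolding simple_def by blast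
qed

end

locale conformal_linear_map = lie_conformal_superalgebra act gr br
  for act :: "complex poly \<Rightarrow> 'a::ab_group_add \<Rightarrow> 'a"
    and gr :: "bit \<Rightarrow> 'a set"
    and br :: "'a \<Rightarrow> 'a \<Rightarrow> 'a poly" +
  fixes \<alpha> :: bit and \<phi> :: "'a \<Rightarrow> 'a poly"
  assumes conformal_linear: "conformal_linear \<alpha> \<phi>"
begin

definition phi_at :: "complex \<Rightarrow> 'a \<Rightarrow> 'a"
  where "phi_at x a = ev [:x:] (\<phi> a)"

sublocale phi_at: semilinear_map act "[:x, 1:]" "phi_at x" for x
  using conformal_linear
  by (unfold_locales)
    (simp_all add: phi_at_def conformal_linear_def ev.add ev_pCons ev_map_poly_act add.commute
      flip: scale_left_distrib)

lemma gr_phi_at: "a \<in> gr i \<Longrightarrow> phi_at x a \<in> gr (\<alpha> + i)"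
  using conformal_linear unfolding phi_at_def conformal_linear_def by (intro gr_ev) auto

lemma fev_fmap: "fev s (fmap \<phi> u) = phi_at (s Ex) (fev s u)"
  by (simp add: fmap_def fev.sum fev_mono_mult fev_psubst_lin_mult fev_def[of s u] phi_at.sum
      phi_at.cmult flip: phi_at_def)

text \<open>\<open>i\<close> is the parity of \<open>a\<close>.\<close>

definition defect :: "complex \<Rightarrow> complex \<Rightarrow> bit \<Rightarrow> 'a \<Rightarrow> 'a \<Rightarrow> 'a"
  where "defect x n i a b =
    phi_at x (br_at n a b) - br_at (n + x) (phi_at x a) b - psign (\<alpha> * i) (br_at n a (phi_at x b))"

lemma gr_defect:
  assumes a: "a \<in> gr i" and b: "b \<in> gr j"
  shows "defect x n i a b \<in> gr (\<alpha> + (i + j))"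
proof -
  have "phi_at x (br_at n a b) \<in> gr (\<alpha> + (i + j))"
    by (intro gr_phi_at gr_br_at a b)
  moreover have "br_at (n + x) (phi_at x a) b \<in> gr (\<alpha> + (i + j))"
    using gr_br_at[OF gr_phi_at[OF a] b] by (simp only: add.assoc)
  moreover have "br_at n a (phi_at x b) \<in> gr (\<alpha> + (i + j))"
    using gr_br_at[OF a gr_phi_at[OF b]] by (simp only: add.left_commute)
  ultimately show ?thesis
    unfolding defect_def by (intro subspace_diff gr_psign gr_submodule)
qed

sublocale defect_left: semilinear_map act "[:- n:]" "\<lambda>a. defect x n i a b" for x n i b
proof -
  have "semilinear_map act [:- n:] (\<lambda>a. phi_at x (br_at n a b))"
    using semilinear_map_compose[OF br_at_left.semilinear_map_axioms
        phi_at.semilinear_map_axioms, of n x b] by simp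
  moreover have "semilinear_map act [:- n:] (\<lambda>a. br_at (n + x) (phi_at x a) b)"
    using semilinear_map_compose[OF phi_at.semilinear_map_axioms
        br_at_left.semilinear_map_axioms, of x "n + x" b] by (simp add: pcompose_pCons)
  ultimately show "semilinear_map act [:- n:] (\<lambda>a. defect x n i a b)"
    unfolding defect_def
    by (intro semilinear_map_diff br_at_left.semilinear_map_psign)
qed

sublocale defect_right: semilinear_map act "[:n + x, 1:]" "defect x n i a" for x n i a
proof -
  have "semilinear_map act [:n + x, 1:] (\<lambda>b. phi_at x (br_at n a b))"
    using semilinear_map_compose[OF br_at_right.semilinear_map_axioms
        phi_at.semilinear_map_axioms, of n x a] by (simp add: pcompose_pCons)
  moreover have "semilinear_map act [:n + x, 1:] (\<lambda>b. psign (\<alpha> * i) (br_at n a (phi_at x b)))"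
    using semilinear_map_compose[OF phi_at.semilinear_map_axioms
        br_at_right.semilinear_map_psign, of x n "\<alpha> * i" a] by (simp add: pcompose_pCons add.commute)
  ultimately show "semilinear_map act [:n + x, 1:] (defect x n i a)"
    unfolding defect_def
    by (intro semilinear_map_diff br_at_right.semilinear_map_axioms)
qed

lemma conformal_derivation_iff_defect:
  "conformal_derivation \<alpha> \<phi> \<longleftrightarrow>
    (\<forall>i j. \<forall>a\<in>gr i. \<forall>b\<in>gr j. \<forall>n x. defect x n i a b = 0)"
  unfolding conformal_derivation_def fpoly_eq_iff_fev
  by (simp add: conformal_linear fev.add fev.psign fev_fbr fev_fmap defect_def diff_diff_eq
      add.commute)

lemma conformal_triple_derivation_iff_defect:
  "conformal_triple_derivation \<alpha> \<phi> \<longleftrightarrow>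
    (\<forall>i j k. \<forall>a\<in>gr i. \<forall>b\<in>gr j. \<forall>c\<in>gr k. \<forall>l m x.
      defect x (l + m) (i + j) (br_at l a b) c = - br_at (l + m + x) (defect x l i a b) c)"
proof -
  have regroup: "p - q - r = - (q - s - t) \<longleftrightarrow> p = s + t + r" for p q r s t :: 'a
    by (auto simp: algebra_simps)
  show ?thesis
    unfolding conformal_triple_derivation_def fpoly_eq_iff_fev defect_def br_at_left.diff
      br_at_left.psign regroup
    by (simp add: conformal_linear fev.add fev.psign fev_fbr fev_fmap add.assoc
        del: add_bit_eq_xor mult_bit_eq_and)
qed

lemma triple_derivation_if_derivation:
  assumes "conformal_derivation \<alpha> \<phi>"
  shows "conformal_triple_derivation \<alpha> \<phi>"
proof -
  have defect_0: "defect x n i a b = 0" if "a \<in> gr i" "b \<in> gr j" for x n i j a b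
    using assms that unfolding conformal_derivation_iff_defect by blast
  show ?thesis
    unfolding conformal_triple_derivation_iff_defect
    using defect_0 defect_0[OF gr_br_at] by (simp add: br_at_left.zero)
qed

text \<open>
  By skew-symmetry the hypothesis becomes the conclusion when the formal operator \<open>-n-x-\<partial>\<close> is
  substituted for its variable.
\<close>

lemma phi_at_br_at_flip:
  assumes w: "w \<in> gr g" and c: "c \<in> gr k" and u: "u \<in> gr (\<alpha> + g)"
    and phi_br: "\<And>n. phi_at x (br_at n w c) =
      br_at (n + x) u c + psign (\<alpha> * g) (br_at n w (phi_at x c))"
  shows "phi_at x (br_at n c w) = br_at (n + x) (phi_at x c) w + psign (\<alpha> * k) (br_at n c u)"
proof -
  obtain q where q: "\<And>t. ev t q = ev (t + [:x:]) (br u c)"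
    using ex_ev_shift by blast
  have "phi_at x (ev [:m:] (br w c)) = ev [:m:] (q + psign (\<alpha> * g) (br w (phi_at x c)))" for m
    using phi_br[of m] by (simp add: br_at_def ev.add ev.psign q)
  from phi_at.ev_pcompose_eqI[OF this, of "[:- n, - 1:]"]
  have "phi_at x (ev [:- n, - 1:] (br w c)) = ev [:- n, - 1:] (br u c)
      + psign (\<alpha> * g) (ev [:- (n + x), - 1:] (br w (phi_at x c)))"
    by (simp add: pcompose_pCons ev.add ev.psign q)
  then have "- psign (k * g) (phi_at x (br_at n c w)) = - psign (k * (\<alpha> + g)) (br_at n c u)
      + psign (\<alpha> * g) (- psign ((\<alpha> + k) * g) (br_at (n + x) (phi_at x c) w))"
    by (simp only: ev_br_skew[OF c w] ev_br_skew[OF c u] ev_br_skew[OF gr_phi_at[OF c] w]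
        phi_at.minus phi_at.psign)
  then show ?thesis
    by (cases \<alpha>; cases g; cases k) (simp_all add: algebra_simps)
qed

end

locale conformal_triple_derivation_map = conformal_linear_map +
  assumes triple_derivation: "conformal_triple_derivation \<alpha> \<phi>"
begin

lemma defect_br_at_left:
  assumes "a \<in> gr i" "b \<in> gr j" "c \<in> gr k"
  shows "defect x n (i + j) (br_at l a b) c = - br_at (n + x) (defect x l i a b) c"
proof -
  have "defect x (l + (n - l)) (i + j) (br_at l a b) c =
      - br_at (l + (n - l) + x) (defect x l i a b) c"
    using triple_derivation assms unfolding conformal_triple_derivation_iff_defect by blast
  then show ?thesis by simp
qed

lemma defect_br_at_right:
  assumes a: "a \<in> gr i" and b: "b \<in> gr j" and c: "c \<in> gr k"
  shows "defect x n k c (br_at l a b) = - psign (\<alpha> * k) (br_at n c (defect x l i a b))"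
proof -
  let ?w = "br_at l a b" and ?d = "defect x l i a b"
  have w: "?w \<in> gr (i + j)"
    using a b by (rule gr_br_at)
  have "phi_at x ?w - ?d \<in> gr (\<alpha> + (i + j))"
    using gr_defect[OF a b] gr_phi_at[OF w] gr_submodule by (intro subspace_diff)
  moreover have "phi_at x (br_at m ?w c) =
      br_at (m + x) (phi_at x ?w - ?d) c + psign (\<alpha> * (i + j)) (br_at m ?w (phi_at x c))" for m
    using defect_br_at_left[OF a b c, of x m l]
    unfolding defect_def[of x m] br_at_left.diff diff_eq_eq by simp
  ultimately have "phi_at x (br_at n c ?w) =
      br_at (n + x) (phi_at x c) ?w + psign (\<alpha> * k) (br_at n c (phi_at x ?w - ?d))"
    by (rule phi_at_br_at_flip[OF w c])
  then show ?thesis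
    unfolding defect_def[of x n] br_at_right.diff psign.diff by simp
qed

lemma defect_cocycle:
  assumes "center = {0}" and a: "a \<in> gr i" and b: "b \<in> gr j" and c: "c \<in> gr k"
  shows "defect x l i a (br_at m b c) = defect x (l + m) (i + j) (br_at l a b) c
    + psign (i * j) (defect x m j b (br_at l a c))"
proof (rule eq_if_br_at_left_eq[OF \<open>center = {0}\<close>])
  show "defect x l i a (br_at m b c) \<in> gr (\<alpha> + (i + j + k))"
    using gr_defect[OF a gr_br_at[OF b c]] by (simp only: ac_simps)
  have "defect x (l + m) (i + j) (br_at l a b) c \<in> gr (\<alpha> + (i + j + k))"
    by (intro gr_defect gr_br_at a b c)
  moreover have "defect x m j b (br_at l a c) \<in> gr (\<alpha> + (i + j + k))"
    using gr_defect[OF b gr_br_at[OF a c]] by (simp only: ac_simps)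
  ultimately show "defect x (l + m) (i + j) (br_at l a b) c
      + psign (i * j) (defect x m j b (br_at l a c)) \<in> gr (\<alpha> + (i + j + k))"
    by (intro subspace_add gr_psign gr_submodule)
next
  fix n h z
  assume z: "z \<in> gr h"
  let ?D = "\<lambda>u. defect x (n - x) (i + j + k) u z"
  have br_defect: "br_at n (defect x p g u v) z = - ?D (br_at p u v)"
    if "u \<in> gr g" "v \<in> gr g'" "g + g' = i + j + k" for p g g' u v
    using defect_br_at_left[OF that(1,2) z, of x "n - x" p] that(3) by simp
  have "br_at n (defect x l i a (br_at m b c)) z = - ?D (br_at l a (br_at m b c))"
    by (rule br_defect[OF a gr_br_at[OF b c]]) (simp only: add.assoc)
  also have "\<dots> = - ?D (br_at (l + m) (br_at l a b) c)
      + psign (i * j) (- ?D (br_at m b (br_at l a c)))"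
    unfolding br_at_jacobi[OF a b c]
    by (simp only: defect_left.add defect_left.psign psign.minus minus_add_distrib)
  also have "- ?D (br_at (l + m) (br_at l a b) c) =
      br_at n (defect x (l + m) (i + j) (br_at l a b) c) z"
    by (rule br_defect[OF gr_br_at[OF a b] c, symmetric]) simp
  also have "- ?D (br_at m b (br_at l a c)) = br_at n (defect x m j b (br_at l a c)) z"
    by (rule br_defect[OF b gr_br_at[OF a c], symmetric]) (simp only: ac_simps)
  finally show "br_at n (defect x l i a (br_at m b c)) z =
      br_at n (defect x (l + m) (i + j) (br_at l a b) c
        + psign (i * j) (defect x m j b (br_at l a c))) z"
    by (simp only: br_at_left.add br_at_left.psign)
qed

lemma defect_br_at_anticocycle:
  fixes p :: complex
  assumes a1: "a1 \<in> gr i1" and a2: "a2 \<in> gr i2" and b: "b \<in> gr j" and c: "c \<in> gr k"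
  defines "i \<equiv> i1 + i2" and "a \<equiv> br_at p a1 a2"
  shows "- defect x l i a (br_at m b c) = defect x (l + m) (i + j) (br_at l a b) c
    + psign (i * j) (defect x m j b (br_at l a c))"
proof -
  let ?d = "defect x p i1 a1 a2"
  have a: "a \<in> gr i"
    unfolding a_def i_def using a1 a2 by (rule gr_br_at)
  have d: "?d \<in> gr (\<alpha> + i)"
    unfolding i_def using a1 a2 by (rule gr_defect)
  have br_d: "br_at (l + x) ?d y = - defect x l i a y" if "y \<in> gr h" for h y
    using defect_br_at_left[OF a1 a2 that] by (simp add: a_def i_def)
  have "- defect x l i a (br_at m b c) = br_at (l + x) ?d (br_at m b c)"
    by (simp add: br_d[OF gr_br_at[OF b c]])
  also have "\<dots> = br_at (l + x + m) (br_at (l + x) ?d b) c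
      + psign ((\<alpha> + i) * j) (br_at m b (br_at (l + x) ?d c))"
    by (rule br_at_jacobi[OF d b c])
  also have "\<dots> = - br_at (l + m + x) (defect x l i a b) c
      + psign (i * j) (- psign (\<alpha> * j) (br_at m b (defect x l i a c)))"
    by (simp only: br_d[OF b] br_d[OF c] br_at_left.minus br_at_right.minus psign.minus
        psign_psign distrib_right add.commute[of "i * j"] add.assoc add.commute[of x m])
  also have "\<dots> = defect x (l + m) (i + j) (br_at l a b) c
      + psign (i * j) (defect x m j b (br_at l a c))"
    by (simp only: defect_br_at_left[OF a b c] defect_br_at_right[OF a c b])
  finally show ?thesis .
qed

lemma defect_br_at_br_at_eq_0:
  assumes "center = {0}"
    and a: "a1 \<in> gr i1" "a2 \<in> gr i2" and b: "b \<in> gr j" and c: "c \<in> gr k"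
  shows "defect x l (i1 + i2) (br_at p a1 a2) (br_at m b c) = 0" (is "?D = 0")
proof -
  have "- ?D = ?D"
    unfolding defect_br_at_anticocycle[OF a b c]
    by (rule defect_cocycle[OF \<open>center = {0}\<close> gr_br_at[OF a] b c, symmetric])
  then have "?D + ?D = 0"
    by (metis left_minus)
  then have "cmult act (1 + 1) ?D = 0"
    by (simp only: C.scale_left_distrib C.scale_one)
  then show ?thesis
    by (simp only: C.scale_eq_0_iff) simp
qed

lemma defect_eq_0:
  assumes "center = {0}" and perfect: "derived = UNIV" and a: "a \<in> gr i"
  shows "defect x n i a b = 0"
proof -
  have defect_br_at: "br_at l u v \<in> {a \<in> gr (g + h). defect x n (g + h) a b = 0}"
    if "u \<in> gr g" "v \<in> gr h" for l u v g h
  proof -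
    have "derived \<subseteq> {y. defect x n (g + h) (br_at l u v) y = 0}"
      by (rule derived_subset[OF defect_right.subspace_kernel])
        (use defect_br_at_br_at_eq_0[OF \<open>center = {0}\<close> that] in blast)
    then show ?thesis
      using perfect gr_br_at[OF that] by blast
  qed
  have "subspace {a \<in> gr j. defect x n j a b = 0}" for j
    using subspace_inter[OF gr_submodule[of j] defect_left.subspace_kernel[of x n j b]]
    by (simp add: Int_def)
  then have "gr i \<subseteq> {a \<in> gr i. defect x n i a b = 0}"
    by (rule gr_subset_if_perfect[OF perfect]) (use defect_br_at in auto)
  with a show ?thesis by blast
qed

end

context lie_conformal_superalgebra
begin

theorem conformal_triple_derivation_iff_derivation:
  assumes "center = {0}" and "derived = UNIV"
  shows "conformal_triple_derivation \<alpha> \<phi> \<longleftrightarrow> conformal_derivation \<alpha> \<phi>"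
proof
  assume triple: "conformal_triple_derivation \<alpha> \<phi>"
  then interpret conformal_triple_derivation_map act gr br \<alpha> \<phi>
    by unfold_locales (simp_all add: conformal_triple_derivation_def)
  show "conformal_derivation \<alpha> \<phi>"
    using defect_eq_0[OF assms] by (simp add: conformal_derivation_iff_defect)
next
  assume derivation: "conformal_derivation \<alpha> \<phi>"
  then interpret conformal_linear_map act gr br \<alpha> \<phi>
    by unfold_locales (simp add: conformal_derivation_def)
  show "conformal_triple_derivation \<alpha> \<phi>"
    using derivation by (rule triple_derivation_if_derivation)
qed

end

theorem theorem4p4:
  fixes act :: "complex poly \<Rightarrow> 'a::ab_group_add \<Rightarrow> 'a"
    and gr :: "bit \<Rightarrow> 'a set"
    and br :: "'a \<Rightarrow> 'a \<Rightarrow> 'a poly"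
  assumes "lie_conformal_superalgebra act gr br"
    and "lie_conformal_superalgebra.fin_gen act"
    and "lie_conformal_superalgebra.simple act br"
  shows "(\<forall>\<alpha> \<phi>. lie_conformal_superalgebra.conformal_triple_derivation act gr br \<alpha> \<phi> \<longleftrightarrow>
            lie_conformal_superalgebra.conformal_derivation act gr br \<alpha> \<phi>) \<and>
         lie_conformal_superalgebra.CTDer act gr br = lie_conformal_superalgebra.CDer act gr br"
proof -
  interpret lie_conformal_superalgebra act gr br
    by fact
  have "center = {0}" and "derived = UNIV"
    using assms(3) by (rule center_eq_0_if_simple, rule derived_eq_UNIV_if_simple)
  note conformal_triple_derivation_iff_derivation[OF this]
  then show ?thesis
    by (simp add: CTDer_def CDer_def)
qed

end
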